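(* Let $f\colon X\to Y$ be a continuous surjection between path-connected metric absolute neighbourhood retracts. Then $$\mathrm{TC}(f)\le \mathrm{cat}(X)+\mathrm{cat}(X)\cdot\mathrm{sec}(f)-1.$$
   Context: Let $I=[0,1]$ and let $X^I$ be the space of continuous paths in $X$ with the compact-open topology. For a continuous surjection $p\colon E\to B$, the sectional number $\mathrm{sec}(p)$ is the minimal integer $n$ for which there is an increasing sequence of open subsets $\emptyset=U_0\subseteq U_1\subseteq\cdots\subseteq U_n=B$ such that for each $i=1,\dots,n$ there is a continuous partial section of $p$ over $U_i-U_{i-1}$, i.e. a continuous map $s\colon U_i-U_{i-1}\to E$ with $p(s(b))=b$ for all $b$; if no such $n$ exists, $\mathrm{sec}(p)=\infty$. The Lusternik-Schnirelmann category is $\mathrm{cat}(X)=\mathrm{sec}(\mathrm{ev}_1\colon PX\to X)$, where $PX\subset X^I$ is the space of paths starting at a fixed base point $x_0$ and $\mathrm{ev}_1(\alpha)=\alpha(1)$ (so $\mathrm{cat}(X)=1$ iff $X$ is contractible). For a continuous surjection $f\colon X\to Y$ between path-connected spaces, $\mathrm{TC}(f)=\mathrm{sec}(\pi_f)$, where $\pi_f\colon X^I\to X\times Y$, $\pi_f(\alpha)=(\alpha(0),f(\alpha(1)))$. *)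

theory Defs
  imports "HOL-Analysis.Analysis"
begin

text \<open>
  Spaces are abstract topologies. A path in \<open>X\<close> is a continuous map on the unit interval,
  represented by the function that is \<open>undefined\<close> outside of it, so that equality of
  paths is equality of functions.
\<close>

definition paths :: "'a topology \<Rightarrow> (real \<Rightarrow> 'a) set" where
  "paths X = {g \<in> extensional {0..1}. pathin X g}"

text \<open>The compact-open topology. The choice \<open>K = {}\<close> shows that its carrier is \<open>paths X\<close>.\<close>

definition path_space :: "'a topology \<Rightarrow> (real \<Rightarrow> 'a) topology" where
  "path_space X = topology_generated_by
     {{g \<in> paths X. g ` K \<subseteq> U} | K U. compactin (top_of_set {0..1}) K \<and> openin X U}"

lemma topspace_path_space [simp]: "topspace (path_space X) = paths X"
proof -
  have "paths X \<in> {{g \<in> paths X. g ` K \<subseteq> U} | K U.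
          compactin (top_of_set {0..1}) K \<and> openin X U}"
    by (rule CollectI, rule exI[of _ "{}"], rule exI[of _ "{}"]) auto
  then show ?thesis
    by (auto simp: path_space_def topology_generated_by_topspace)
qed

definition based_path_space :: "'a topology \<Rightarrow> 'a \<Rightarrow> (real \<Rightarrow> 'a) topology" where
  "based_path_space X x0 = subtopology (path_space X) {g. g 0 = x0}"

definition partial_section ::
    "'e topology \<Rightarrow> 'b topology \<Rightarrow> ('e \<Rightarrow> 'b) \<Rightarrow> 'b set \<Rightarrow> ('b \<Rightarrow> 'e) \<Rightarrow> bool" where
  "partial_section E B p A s \<longleftrightarrow>
     continuous_map (subtopology B A) E s \<and> (\<forall>b\<in>A. p (s b) = b)"

definition sectional_filtration ::
    "'e topology \<Rightarrow> 'b topology \<Rightarrow> ('e \<Rightarrow> 'b) \<Rightarrow> nat \<Rightarrow> (nat \<Rightarrow> 'b set) \<Rightarrow> bool" where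
  "sectional_filtration E B p n U \<longleftrightarrow>
     U 0 = {} \<and> U n = topspace B \<and>
     (\<forall>i\<le>n. openin B (U i)) \<and>
     (\<forall>i\<in>{1..n}. U (i - 1) \<subseteq> U i \<and> (\<exists>s. partial_section E B p (U i - U (i - 1)) s))"

text \<open>The infimum of the empty set in \<^typ>\<open>enat\<close> is \<open>\<infinity>\<close>.\<close>

definition sec :: "'e topology \<Rightarrow> 'b topology \<Rightarrow> ('e \<Rightarrow> 'b) \<Rightarrow> enat" where
  "sec E B p = Inf {enat n | n. \<exists>U. sectional_filtration E B p n U}"

definition cat :: "'a topology \<Rightarrow> 'a \<Rightarrow> enat" where
  "cat X x0 = sec (based_path_space X x0) X (\<lambda>\<alpha>. \<alpha> 1)"

definition TC :: "'a topology \<Rightarrow> 'b topology \<Rightarrow> ('a \<Rightarrow> 'b) \<Rightarrow> enat" where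
  "TC X Y f = sec (path_space X) (prod_topology X Y) (\<lambda>\<alpha>. (\<alpha> 0, f (\<alpha> 1)))"

text \<open>
  A metrizable space is an absolute neighbourhood retract if every closed homeomorphic copy
  \<open>S\<close> of it in a metrizable space \<open>Z\<close> is a retract of a neighbourhood of \<open>S\<close> in \<open>Z\<close>. HOL cannot
  quantify over all types of points of \<open>Z\<close>; the type \<open>'a \<Rightarrow> real\<close> loses no generality. It
  contains the Banach space of bounded real functions on \<open>topspace X\<close>, in which
  (Kuratowski--Wojdyslawski) \<open>X\<close> embeds as a closed subset of its convex hull. A neighbourhood
  retract of that hull is an absolute neighbourhood extensor for metrizable spaces by Dugundji's
  theorem, hence a neighbourhood retract of every metrizable space containing it as a closed
  subset.
\<close>

definition metric_ANR :: "'a topology \<Rightarrow> bool" where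
  "metric_ANR X \<longleftrightarrow> metrizable_space X \<and>
     (\<forall>(Z :: ('a \<Rightarrow> real) topology) S.
        metrizable_space Z \<and> closedin Z S \<and> X homeomorphic_space subtopology Z S \<longrightarrow>
        (\<exists>U. openin Z U \<and> S \<subseteq> U \<and> S retract_of_space subtopology Z U))"

end

theory Submission
  imports Defs
begin

text \<open>
  Sectional filtrations behave well under three operations: over a composition \<open>E \<rightarrow> X \<rightarrow> Y\<close>
  lengths multiply, since the sections of the second map pull the filtration of \<open>X\<close> back to each
  stratum of \<open>Y\<close>; for a product of maps lengths add minus one, since the strata with a fixed
  index sum are relatively open in their union; and a filtration for \<open>E \<rightarrow> B\<close> is one for every
  \<open>E' \<rightarrow> B\<close> that receives a map from \<open>E\<close> over \<open>B\<close>. With \<open>PX\<close> the based paths, apply the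
  composition rule to \<open>PX \<rightarrow> X \<rightarrow> Y\<close>, take the product with \<open>PX \<rightarrow> X\<close>, and map \<open>PX \<times> PX\<close> to the
  free path space over \<open>X \<times> Y\<close> by running the first path backwards and then the second.
\<close>

section \<open>Filtrations, their sections, and attainment of the infimum\<close>

lemma sectional_filtration_mono:
  assumes "sectional_filtration E B p n U" "i \<le> j" "j \<le> n"
  shows "U i \<subseteq> U j"
  using assms(2,3)
proof (induction j rule: dec_induct)
  case (step k)
  then have "U (Suc k - 1) \<subseteq> U (Suc k)"
    using assms(1) unfolding sectional_filtration_def
    by (metis atLeastAtMost_iff le_add1 plus_1_eq_Suc)
  with step show ?case by auto
qed auto

text \<open>One section is chosen for every stratum at once. Strata are counted from 0 here, as in
  \<open>sectional_filtrationI\<close>, which suits the division with remainder by which composed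
  filtrations are indexed.\<close>

lemma sectional_filtration_sections:
  assumes "sectional_filtration E B p n U"
  obtains s where "\<And>i. i < n \<Longrightarrow> partial_section E B p (U (Suc i) - U i) (s i)"
proof -
  have "\<exists>t. partial_section E B p (U (Suc i) - U i) t" if "i < n" for i
  proof -
    have "Suc i \<in> {1..n}" using that by auto
    then show ?thesis using assms unfolding sectional_filtration_def by (metis diff_Suc_1)
  qed
  then show thesis using that by metis
qed

lemma sectional_filtrationI:
  assumes "U 0 = {}" "U n = topspace B" "\<And>i. i \<le> n \<Longrightarrow> openin B (U i)"
    and "\<And>i. i < n \<Longrightarrow> U i \<subseteq> U (Suc i)"
    and "\<And>i. i < n \<Longrightarrow> \<exists>s. partial_section E B p (U (Suc i) - U i) s"
  shows "sectional_filtration E B p n U"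
  unfolding sectional_filtration_def
proof (intro conjI ballI allI impI)
  fix i assume "i \<in> {1..n}"
  then obtain k where "i = Suc k" "k < n" by (cases i) auto
  then show "U (i - 1) \<subseteq> U i" "\<exists>s. partial_section E B p (U i - U (i - 1)) s"
    using assms(4,5) by auto
qed (use assms in auto)

lemma sec_le:
  assumes "sectional_filtration E B p n U"
  shows "sec E B p \<le> enat n"
  unfolding sec_def using assms by (intro Inf_lower) auto

text \<open>A finite value excludes the empty set, whose infimum is \<infinity>, and
  \<open>Inf\<close> of a nonempty set of type \<open>enat\<close> is its least element. Hence the
  infimum is attained.\<close>

lemma sec_finiteE:
  assumes "sec E B p = enat n"
  obtains U where "sectional_filtration E B p n U"
proof -
  let ?S = "{enat n | n. \<exists>U. sectional_filtration E B p n U}"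
  have "?S \<noteq> {}"
    using assms unfolding sec_def Inf_enat_def by (auto split: if_splits)
  then have "sec E B p \<in> ?S"
    unfolding sec_def by (metis (lifting) Inf_enat_def LeastI ex_in_conv)
  with assms that show thesis by auto
qed

section \<open>Gluing and transporting partial sections\<close>

lemma partial_section_glue:
  assumes T: "\<And>i. i \<in> I \<Longrightarrow> openin (subtopology B A) (T i)"
    and s: "\<And>i. i \<in> I \<Longrightarrow> partial_section E B p (T i) (s i)"
    and disj: "disjoint_family_on T I"
    and cover: "A \<subseteq> (\<Union>i\<in>I. T i)"
  shows "\<exists>s. partial_section E B p A s"
proof -
  have sub: "T i \<subseteq> A" if "i \<in> I" for i
    using openin_subset[OF T[OF that]] by auto
  obtain g where g: "continuous_map (subtopology B A) E g"
      "\<And>x i. i \<in> I \<Longrightarrow> x \<in> topspace (subtopology B A) \<inter> T i \<Longrightarrow> g x = s i x"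
  proof (rule pasting_lemma_exists)
    show "topspace (subtopology B A) \<subseteq> (\<Union>i\<in>I. T i)" using cover by auto
    show "continuous_map (subtopology (subtopology B A) (T i)) E (s i)" if "i \<in> I" for i
      using s[OF that] sub[OF that]
      by (simp add: partial_section_def subtopology_subtopology Int_absorb1)
    show "s i x = s j x"
      if "i \<in> I" "j \<in> I" "x \<in> topspace (subtopology B A) \<inter> T i \<inter> T j" for i j x
      using that disj by (cases "i = j") (auto simp: disjoint_family_on_def)
  qed (use T in auto)
  have "p (g b) = b" if "b \<in> A" for b
  proof -
    obtain i where i: "i \<in> I" "b \<in> T i" using cover \<open>b \<in> A\<close> by blast
    then have "g b = s i b" using g(2) openin_subset[OF T[OF i(1)]] by auto
    then show ?thesis using s[OF i(1)] i(2) by (auto simp: partial_section_def)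
  qed
  with g(1) show ?thesis unfolding partial_section_def by auto
qed

lemma partial_section_map:
  assumes "partial_section E B p A s" "continuous_map E E' \<phi>" "A \<subseteq> topspace B"
    and "\<And>e. e \<in> topspace E \<Longrightarrow> p' (\<phi> e) = p e"
  shows "partial_section E' B p' A (\<phi> \<circ> s)"
proof -
  have "s b \<in> topspace E" if "b \<in> A" for b
    using assms(1,3) that by (auto simp: partial_section_def continuous_map_def)
  with assms show ?thesis
    by (auto simp: partial_section_def intro: continuous_map_compose)
qed

lemma sectional_filtration_map:
  assumes "sectional_filtration E B p n U" "continuous_map E E' \<phi>"
    and "\<And>e. e \<in> topspace E \<Longrightarrow> p' (\<phi> e) = p e"
  shows "sectional_filtration E' B p' n U"
  unfolding sectional_filtration_def
proof (intro conjI ballI)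
  fix i assume i: "i \<in> {1..n}"
  then have "U i \<subseteq> topspace B"
    using assms(1) by (auto simp: sectional_filtration_def openin_subset)
  then have "U i - U (i - 1) \<subseteq> topspace B" by auto
  then show "\<exists>s. partial_section E' B p' (U i - U (i - 1)) s"
    using assms i partial_section_map[where p = p] unfolding sectional_filtration_def by metis
qed (use assms(1) in \<open>auto simp: sectional_filtration_def\<close>)

section \<open>Composition: lengths multiply\<close>

lemma sectional_filtration_compose:
  assumes U: "sectional_filtration E X p m U" and V: "sectional_filtration X Y f n V"
    and "0 < m"
  shows "\<exists>W. sectional_filtration E Y (f \<circ> p) (m * n) W"
proof -
  obtain s where s: "\<And>i. i < m \<Longrightarrow> partial_section E X p (U (Suc i) - U i) (s i)"
    using sectional_filtration_sections[OF U] by blast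
  obtain t where t: "\<And>j. j < n \<Longrightarrow> partial_section X Y f (V (Suc j) - V j) (t j)"
    using sectional_filtration_sections[OF V] by blast
  have U0: "U 0 = {}" and Um: "U m = topspace X" and Uo: "\<And>i. i \<le> m \<Longrightarrow> openin X (U i)"
    using U by (auto simp: sectional_filtration_def)
  have V0: "V 0 = {}" and Vn: "V n = topspace Y" and Vo: "\<And>j. j \<le> n \<Longrightarrow> openin Y (V j)"
    using V by (auto simp: sectional_filtration_def)
  have VS: "V j \<subseteq> V (Suc j)" if "j < n" for j
    using sectional_filtration_mono[OF V, of j "Suc j"] that by auto
  have US: "U i \<subseteq> U (Suc i)" if "i < m" for i
    using sectional_filtration_mono[OF U, of i "Suc i"] that by auto
  define F where "F j i = V j \<union> {y \<in> V (Suc j) - V j. t j y \<in> U i}" for j i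
  define W where "W k = F (k div m) (k mod m)" for k
  have tX: "t j y \<in> topspace X" if "j < n" "y \<in> V (Suc j) - V j" for j y
  proof -
    have "V (Suc j) \<subseteq> topspace Y" using Vo[of "Suc j"] that by (simp add: openin_subset)
    then show ?thesis
      using t[OF that(1)] that(2) by (auto simp: partial_section_def continuous_map_def)
  qed
  have F0: "F j 0 = V j" for j using U0 by (auto simp: F_def)
  have Fm: "F j m = V (Suc j)" if "j < n" for j
    using tX[OF that] VS[OF that] Um by (auto simp: F_def)
  have Fo: "openin Y (F j i)" if "j < n" "i \<le> m" for j i
  proof -
    have "openin (subtopology Y (V (Suc j) - V j))
        {y \<in> topspace (subtopology Y (V (Suc j) - V j)). t j y \<in> U i}"
      using t[OF that(1)] Uo[OF that(2)]
      unfolding partial_section_def by (blast intro: openin_continuous_map_preimage)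
    moreover have "topspace (subtopology Y (V (Suc j) - V j)) = V (Suc j) - V j"
      using openin_subset[OF Vo[of "Suc j"]] that(1) by auto
    ultimately obtain O' where O: "openin Y O'"
        "{y \<in> V (Suc j) - V j. t j y \<in> U i} = O' \<inter> (V (Suc j) - V j)"
      by (auto simp: openin_subtopology)
    \<comment> \<open>The pulled-back set is open only relative to the stratum, hence of the form
      \<open>O'\<close> intersected with \<open>V (Suc j) - V j\<close>. Adjoining all of
      \<open>V j\<close> fills in the removed part, so the union is open in
      \<open>Y\<close>.\<close>
    then have "F j i = V j \<union> (O' \<inter> V (Suc j))"
      unfolding F_def by auto
    with O(1) show ?thesis using Vo[of j] Vo[of "Suc j"] that by auto
  qed
  \<comment> \<open>Points that are new at step \<open>i\<close> are sent by \<open>t j\<close> into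
    the \<open>i\<close>-th stratum of \<open>X\<close>, where \<open>s i\<close> is defined, so
    \<open>s i \<circ> t j\<close> is the section.\<close>
  have sect: "\<exists>r. partial_section E Y (f \<circ> p) (F j (Suc i) - F j i) r" if "j < n" "i < m" for j i
  proof -
    let ?A = "F j (Suc i) - F j i"
    have A: "?A \<subseteq> V (Suc j) - V j" and tA: "t j ` ?A \<subseteq> U (Suc i) - U i"
      by (auto simp: F_def)
    have "continuous_map (subtopology Y ?A) X (t j)"
      using t[OF that(1)] continuous_map_from_subtopology_mono[OF _ A]
      by (auto simp: partial_section_def)
    then have "continuous_map (subtopology Y ?A) (subtopology X (U (Suc i) - U i)) (t j)"
      using tA by (auto simp: continuous_map_in_subtopology)
    then have "continuous_map (subtopology Y ?A) E (s i \<circ> t j)"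
      using s[OF that(2)] unfolding partial_section_def by (blast intro: continuous_map_compose)
    moreover have "(f \<circ> p) ((s i \<circ> t j) y) = y" if y: "y \<in> ?A" for y
    proof -
      have "p (s i (t j y)) = t j y"
        using s[OF \<open>i < m\<close>] tA y unfolding partial_section_def by blast
      moreover have "f (t j y) = y"
        using t[OF \<open>j < n\<close>] A y unfolding partial_section_def by blast
      ultimately show ?thesis by simp
    qed
    ultimately show ?thesis unfolding partial_section_def by blast
  qed
  have k: "k div m < n" "k mod m < m" "W k = F (k div m) (k mod m)"
      "W (Suc k) = F (k div m) (Suc (k mod m))" if "k < m * n" for k
  proof -
    show *: "k div m < n"
      using that by (simp add: less_mult_imp_div_less mult.commute)
    show "k mod m < m" "W k = F (k div m) (k mod m)" using \<open>0 < m\<close> by (auto simp: W_def)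
    \<comment> \<open>If \<open>k mod m\<close> is \<open>m - 1\<close>, the next index opens a new
      block. The formula survives because the end of one block, \<open>F j m\<close>, equals the
      start of the next, \<open>F (Suc j) 0\<close>; both are \<open>V (Suc j)\<close>.\<close>
    show "W (Suc k) = F (k div m) (Suc (k mod m))"
      using F0 Fm[OF *] by (auto simp: W_def div_Suc mod_Suc)
  qed
  have "sectional_filtration E Y (f \<circ> p) (m * n) W"
  proof (rule sectional_filtrationI)
    show "W 0 = {}" using F0 V0 by (simp add: W_def)
    show Wn: "W (m * n) = topspace Y" using F0 Vn \<open>0 < m\<close> by (simp add: W_def)
    show "openin Y (W i)" if "i \<le> m * n" for i
    proof (cases "i = m * n")
      case False
      then show ?thesis using that k[of i] Fo by auto
    qed (use Wn in simp)
    show "W i \<subseteq> W (Suc i)" if "i < m * n" for i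
      using k[OF that] US by (auto simp: F_def)
    show "\<exists>r. partial_section E Y (f \<circ> p) (W (Suc i) - W i) r" if "i < m * n" for i
      using k[OF that] sect by auto
  qed
  then show ?thesis by blast
qed

section \<open>Products: lengths add minus one\<close>

lemma partial_section_prod:
  assumes "partial_section E X p A s" "partial_section F Y q C t"
  shows "partial_section (prod_topology E F) (prod_topology X Y) (map_prod p q) (A \<times> C) (map_prod s t)"
proof -
  have "continuous_map (prod_topology (subtopology X A) (subtopology Y C)) (prod_topology E F)
      (\<lambda>(x, y). (s x, t y))"
    using assms by (auto simp: continuous_map_prod_top partial_section_def)
  with assms show ?thesis
    by (auto simp: partial_section_def subtopology_Times map_prod_def)
qed

lemma sectional_filtration_prod:
  assumes U: "sectional_filtration E X p m U" and V: "sectional_filtration F Y q n V"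
    and "0 < m" "0 < n"
  shows "\<exists>W. sectional_filtration (prod_topology E F) (prod_topology X Y) (map_prod p q) (m + n - 1) W"
proof -
  obtain s where s: "\<And>i. i < m \<Longrightarrow> partial_section E X p (U (Suc i) - U i) (s i)"
    using sectional_filtration_sections[OF U] by blast
  obtain t where t: "\<And>j. j < n \<Longrightarrow> partial_section F Y q (V (Suc j) - V j) (t j)"
    using sectional_filtration_sections[OF V] by blast
  have U0: "U 0 = {}" and Um: "U m = topspace X" and Uo: "\<And>i. i \<le> m \<Longrightarrow> openin X (U i)"
    using U by (auto simp: sectional_filtration_def)
  have V0: "V 0 = {}" and Vn: "V n = topspace Y" and Vo: "\<And>j. j \<le> n \<Longrightarrow> openin Y (V j)"
    using V by (auto simp: sectional_filtration_def)
  note Umono = sectional_filtration_mono[OF U] and Vmono = sectional_filtration_mono[OF V]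
  \<comment> \<open>Boxes with a zero index are empty, so the index sums that matter run from 2 to
    \<open>m + n\<close>. Shifting by one makes \<open>W 0\<close> empty and leaves
    \<open>m + n - 1\<close> steps.\<close>
  define J where "J k = {(i, j). i \<le> m \<and> j \<le> n \<and> i + j \<le> Suc k}" for k
  define W where "W k = (\<Union>(i, j)\<in>J k. U i \<times> V j)" for k
  have Wo: "openin (prod_topology X Y) (W k)" for k
    unfolding W_def J_def using Uo Vo by (auto simp: openin_prod_Times_iff)
  have "sectional_filtration (prod_topology E F) (prod_topology X Y) (map_prod p q) (m + n - 1) W"
  proof (rule sectional_filtrationI)
    have "U i \<times> V j = {}" if "(i, j) \<in> J 0" for i j
    proof -
      have "i = 0 \<or> j = 0" using that by (auto simp: J_def)
      then show ?thesis using U0 V0 by auto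
    qed
    then show "W 0 = {}" unfolding W_def by fastforce
    have "(m, n) \<in> J (m + n - 1)" using \<open>0 < m\<close> by (auto simp: J_def)
    then have "U m \<times> V n \<subseteq> W (m + n - 1)" unfolding W_def by blast
    then show "W (m + n - 1) = topspace (prod_topology X Y)"
      using openin_subset[OF Wo] Um Vn by auto
    show "W k \<subseteq> W (Suc k)" for k unfolding W_def J_def by fastforce
    show "openin (prod_topology X Y) (W k)" for k by (rule Wo)
    fix k
    let ?A = "W (Suc k) - W k"
    define I where "I = {(i, j). i < m \<and> j < n \<and> i + j = k}"
    define T where "T = (\<lambda>(i, j). (U (Suc i) - U i) \<times> (V (Suc j) - V j))"
    \<comment> \<open>This makes each product of strata relatively open in \<open>?A\<close>. A box
      \<open>U a \<times> V b\<close> in \<open>W k\<close> has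
      \<open>a + b \<le> i + j + 1\<close>, so \<open>a \<le> i\<close> or \<open>b \<le> j\<close>,
      and it misses \<open>T (i, j)\<close>. Conversely, removing \<open>W k\<close> removes both
      \<open>U i \<times> V (Suc j)\<close> and \<open>U (Suc i) \<times> V j\<close>.\<close>
    have T_eq: "T (i, j) = ?A \<inter> (U (Suc i) \<times> V (Suc j))" if "(i, j) \<in> I" for i j
    proof (intro equalityI subsetI)
      have ij: "i < m" "j < n" "i + j = k" using that by (auto simp: I_def)
      fix z assume z: "z \<in> T (i, j)"
      then obtain x y where xy: "z = (x, y)" "x \<in> U (Suc i)" "x \<notin> U i" "y \<in> V (Suc j)" "y \<notin> V j"
        by (auto simp: T_def)
      have "(Suc i, Suc j) \<in> J (Suc k)" using ij by (auto simp: J_def)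
      then have "z \<in> W (Suc k)" using xy unfolding W_def by blast
      moreover have "z \<notin> W k"
      proof
        assume "z \<in> W k"
        then obtain a b where ab: "a \<le> m" "b \<le> n" "a + b \<le> Suc k" "x \<in> U a" "y \<in> V b"
          using xy by (auto simp: W_def J_def)
        have "a \<le> i \<or> b \<le> j" using ab ij by linarith
        then show False using Umono[of a i] Vmono[of b j] ab xy ij by auto
      qed
      ultimately show "z \<in> ?A \<inter> (U (Suc i) \<times> V (Suc j))" using xy by auto
    next
      have ij: "i < m" "j < n" "i + j = k" using that by (auto simp: I_def)
      then have "(i, Suc j) \<in> J k" "(Suc i, j) \<in> J k" by (auto simp: J_def)
      then have "U i \<times> V (Suc j) \<subseteq> W k" "U (Suc i) \<times> V j \<subseteq> W k" unfolding W_def by blast+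
      moreover fix z assume "z \<in> ?A \<inter> (U (Suc i) \<times> V (Suc j))"
      ultimately show "z \<in> T (i, j)" by (auto simp: T_def)
    qed
    show "\<exists>r. partial_section (prod_topology E F) (prod_topology X Y) (map_prod p q) ?A r"
    proof (rule partial_section_glue[where I = I and T = T])
      show "openin (subtopology (prod_topology X Y) ?A) (T z)" if "z \<in> I" for z
      proof -
        obtain i j where z: "z = (i, j)" "i < m" "j < n" using \<open>z \<in> I\<close> by (auto simp: I_def)
        then have "openin (prod_topology X Y) (U (Suc i) \<times> V (Suc j))"
          using Uo Vo by (simp add: openin_prod_Times_iff)
        then show ?thesis
          using T_eq that z(1) by (auto simp: openin_subtopology_Int2)
      qed
      show "partial_section (prod_topology E F) (prod_topology X Y) (map_prod p q) (T z)
          ((\<lambda>(i, j). map_prod (s i) (t j)) z)" if "z \<in> I" for z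
        using that s t by (auto simp: I_def T_def intro: partial_section_prod)
      show "disjoint_family_on T I"
        unfolding disjoint_family_on_def
      proof (intro ballI impI)
        fix z z' assume "z \<in> I" "z' \<in> I" "z \<noteq> z'"
        have *: "T (i, j) \<inter> T (i', j') = {}" if "(i', j') \<in> I" "i < i'" for i j i' j'
          using that Umono[of "Suc i" i'] by (auto simp: T_def I_def)
        \<comment> \<open>The index sum is fixed on \<open>I\<close>, so distinct pairs already
          differ in the first index.\<close>
        obtain i j i' j' where "z = (i, j)" "z' = (i', j')" "i < i' \<or> i' < i"
          using \<open>z \<in> I\<close> \<open>z' \<in> I\<close> \<open>z \<noteq> z'\<close> by (fastforce simp: I_def)
        then show "T z \<inter> T z' = {}"
          using *[of i' j' i j] *[of i j i' j'] \<open>z \<in> I\<close> \<open>z' \<in> I\<close> by (auto simp: Int_commute)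
      qed
      show "?A \<subseteq> (\<Union>z\<in>I. T z)"
      proof
        fix z assume z: "z \<in> ?A"
        then obtain a b where ab: "(a, b) \<in> J (Suc k)" "z \<in> U a \<times> V b" by (auto simp: W_def)
        \<comment> \<open>Membership in \<open>J (Suc k)\<close> but not in \<open>J k\<close>
          forces \<open>a + b = k + 2\<close>, hence \<open>i + j = k\<close> for the
          predecessors.\<close>
        have "(a, b) \<notin> J k" using z ab(2) unfolding W_def by blast
        moreover obtain i j where "a = Suc i" "b = Suc j"
          using ab(2) U0 V0 by (cases a; cases b) auto
        ultimately have "(i, j) \<in> I" "z \<in> ?A \<inter> (U (Suc i) \<times> V (Suc j))"
          using ab z by (auto simp: J_def I_def)
        then show "z \<in> (\<Union>z\<in>I. T z)" using T_eq by blast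
      qed
    qed
  qed
  then show ?thesis by blast
qed

section \<open>Joining a reversed based path to a second one\<close>

definition rev_join :: "(real \<Rightarrow> 'a) \<Rightarrow> (real \<Rightarrow> 'a) \<Rightarrow> real \<Rightarrow> 'a" where
  "rev_join a b = restrict (\<lambda>t. if t \<le> 1/2 then a (1 - 2 * t) else b (2 * t - 1)) {0..1}"

lemma rev_join_0 [simp]: "rev_join a b 0 = a 1"
  and rev_join_1 [simp]: "rev_join a b 1 = b 1"
  by (auto simp: rev_join_def)

lemma rev_join_in_paths:
  assumes "a \<in> paths X" "b \<in> paths X" "a 0 = b 0"
  shows "rev_join a b \<in> paths X"
proof -
  have ab: "continuous_map (top_of_set {0..1}) X a" "continuous_map (top_of_set {0..1}) X b"
    using assms by (auto simp: paths_def pathin_def)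
  have "continuous_map (top_of_set {0..1}) X (\<lambda>t. if t \<le> 1/2 then a (1 - 2 * t) else b (2 * t - 1))"
  proof (rule continuous_map_cases_le)
    let ?L = "subtopology (top_of_set {0..1}) {t \<in> topspace (top_of_set {0..1}). t \<le> (1/2::real)}"
    let ?R = "subtopology (top_of_set {0..1}) {t \<in> topspace (top_of_set {0..1}). (1/2::real) \<le> t}"
    have "continuous_map ?L (top_of_set {0..1}) (\<lambda>t. 1 - 2 * t)"
      by (auto simp: subtopology_subtopology continuous_map_in_subtopology intro!: continuous_intros)
    from continuous_map_compose[OF this ab(1)]
    show "continuous_map ?L X (\<lambda>t. a (1 - 2 * t))" by (simp add: o_def)
    have "continuous_map ?R (top_of_set {0..1}) (\<lambda>t. 2 * t - 1)"
      by (auto simp: subtopology_subtopology continuous_map_in_subtopology intro!: continuous_intros)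
    from continuous_map_compose[OF this ab(2)]
    show "continuous_map ?R X (\<lambda>t. b (2 * t - 1))" by (simp add: o_def)
  \<comment> \<open>At \<open>t = 1/2\<close> the two formulas give \<open>a 0\<close> and
    \<open>b 0\<close>, which agree.\<close>
  qed (use assms(3) in \<open>auto intro!: continuous_intros simp: mult.commute[of 2]\<close>)
  then have "continuous_map (top_of_set {0..1}) X (rev_join a b)"
    by (rule continuous_map_eq) (auto simp: rev_join_def)
  then show ?thesis by (auto simp: paths_def pathin_def rev_join_def)
qed

lemma openin_path_space_subbasic:
  assumes "compact K" "K \<subseteq> {0..1}" "openin X U"
  shows "openin (path_space X) {g \<in> paths X. g ` K \<subseteq> U}"
  unfolding path_space_def
  using assms by (intro topology_generated_by_Basis) (auto simp: compactin_subtopology)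

text \<open>A subbasic condition on the joined path splits into one such condition on each factor:
  cut \<open>K\<close> at 1/2 and reparametrise the halves. Both cuts are closed, which keeps the
  halves compact; the point 1/2 may lie in both because the starting points coincide.\<close>

lemma rev_join_image_subset_iff:
  assumes "a 0 = b 0" "K \<subseteq> {0..1}"
  shows "rev_join a b ` K \<subseteq> U \<longleftrightarrow>
    a ` (\<lambda>t. 1 - 2 * t) ` (K \<inter> {..1/2}) \<subseteq> U \<and> b ` (\<lambda>t. 2 * t - 1) ` (K \<inter> {1/2..}) \<subseteq> U"
proof -
  have "rev_join a b t = a (1 - 2 * t)" if "t \<in> K \<inter> {..1/2}" for t
    using that assms(2) by (auto simp: rev_join_def)
  moreover have "rev_join a b t = b (2 * t - 1)" if "t \<in> K \<inter> {1/2..}" for t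
    using that assms by (cases "t = 1/2") (auto simp: rev_join_def subset_iff mult.commute[of 2])
  moreover have "K = (K \<inter> {..1/2}) \<union> (K \<inter> {1/2..})" by auto
  then have "rev_join a b ` K = rev_join a b ` (K \<inter> {..1/2}) \<union> rev_join a b ` (K \<inter> {1/2..})"
    by blast
  ultimately show ?thesis by (auto simp: image_image)
qed

text \<open>It suffices to test subbasic sets of the compact-open topology. By the splitting of
  \<open>K\<close>, the preimage of such a set is a product of two subbasic sets cut down to based
  paths.\<close>

lemma continuous_map_rev_join:
  "continuous_map (prod_topology (based_path_space X x0) (based_path_space X x0)) (path_space X)
     (\<lambda>(a, b). rev_join a b)"
proof -
  let ?P = "based_path_space X x0"
  have top: "topspace ?P = {g \<in> paths X. g 0 = x0}" by (auto simp: based_path_space_def)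
  show ?thesis
    unfolding path_space_def
  proof (rule continuous_on_generated_topo)
    fix S assume "S \<in> {{g \<in> paths X. g ` K \<subseteq> U} |K U. compactin (top_of_set {0..1}) K \<and> openin X U}"
    then obtain K U where S: "S = {g \<in> paths X. g ` K \<subseteq> U}"
      and K: "compact K" "K \<subseteq> {0..1}" and U: "openin X U"
      by (auto simp: compactin_subtopology)
    let ?K1 = "(\<lambda>t. 1 - 2 * t) ` (K \<inter> {..1/2})" and ?K2 = "(\<lambda>t. 2 * t - 1) ` (K \<inter> {1/2..})"
    have "compact ?K1" "compact ?K2"
      using K by (auto intro!: compact_continuous_image continuous_intros compact_Int_closed)
    moreover have "?K1 \<subseteq> {0..1}" "?K2 \<subseteq> {0..1}" using K(2) by auto
    ultimately have sub: "openin (path_space X) {g \<in> paths X. g ` ?K1 \<subseteq> U}"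
        "openin (path_space X) {g \<in> paths X. g ` ?K2 \<subseteq> U}"
      using U by (blast intro: openin_path_space_subbasic)+
    have "openin ?P ({g. g 0 = x0} \<inter> {g \<in> paths X. g ` ?K1 \<subseteq> U})"
        "openin ?P ({g. g 0 = x0} \<inter> {g \<in> paths X. g ` ?K2 \<subseteq> U})"
      using sub by (auto simp only: based_path_space_def openin_subtopology_Int2)
    then have "openin (prod_topology ?P ?P) (({g. g 0 = x0} \<inter> {g \<in> paths X. g ` ?K1 \<subseteq> U}) \<times>
        ({g. g 0 = x0} \<inter> {g \<in> paths X. g ` ?K2 \<subseteq> U}))"
      by (simp only: openin_prod_Times_iff simp_thms)
    also have "({g. g 0 = x0} \<inter> {g \<in> paths X. g ` ?K1 \<subseteq> U}) \<times>
        ({g. g 0 = x0} \<inter> {g \<in> paths X. g ` ?K2 \<subseteq> U}) =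
        (\<lambda>(a, b). rev_join a b) -` S \<inter> topspace (prod_topology ?P ?P)"
    proof (intro set_eqI)
      fix z :: "(real \<Rightarrow> 'a) \<times> (real \<Rightarrow> 'a)"
      obtain a b where z: "z = (a, b)" by force
      show "z \<in> ({g. g 0 = x0} \<inter> {g \<in> paths X. g ` ?K1 \<subseteq> U}) \<times>
            ({g. g 0 = x0} \<inter> {g \<in> paths X. g ` ?K2 \<subseteq> U}) \<longleftrightarrow>
          z \<in> (\<lambda>(a, b). rev_join a b) -` S \<inter> topspace (prod_topology ?P ?P)"
      proof (cases "a \<in> paths X \<and> b \<in> paths X \<and> a 0 = x0 \<and> b 0 = x0")
        case True
        then show ?thesis
          using rev_join_in_paths[of a X b] rev_join_image_subset_iff[of a b K U] K(2)
          unfolding z S topspace_prod_topology top by simp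
      next
        case False
        then show ?thesis unfolding z S topspace_prod_topology top by auto
      qed
    qed
    finally show "openin (prod_topology ?P ?P)
        ((\<lambda>(a, b). rev_join a b) -` S \<inter> topspace (prod_topology ?P ?P))" .
  next
    have "rev_join a b \<in> topspace (path_space X)" if "a \<in> topspace ?P" "b \<in> topspace ?P" for a b
      using that rev_join_in_paths[of a X b] by (auto simp: top)
    then show "(\<lambda>(a, b). rev_join a b) ` topspace (prod_topology ?P ?P) \<subseteq>
        \<Union> {{g \<in> paths X. g ` K \<subseteq> U} |K U. compactin (top_of_set {0..1}) K \<and> openin X U}"
      unfolding path_space_def topology_generated_by_topspace by auto
  qed
qed

text \<open>At length 0 the empty set and the whole base would coincide. Positive lengths are what
  the composition and product constructions assume.\<close>

lemma sectional_filtration_length_pos: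
  assumes "sectional_filtration E B p n U" "topspace B \<noteq> {}"
  shows "0 < n"
  using assms by (cases n) (auto simp: sectional_filtration_def)

section \<open>Assembly of the inequality\<close>

theorem theorem3p17:
  fixes X :: "'a topology" and Y :: "'b topology" and f :: "'a \<Rightarrow> 'b" and x0 :: 'a
  assumes "path_connected_space X" and "path_connected_space Y"
    and "metric_ANR X" and "metric_ANR Y"
    and "continuous_map X Y f" and "f ` topspace X = topspace Y"
    and "x0 \<in> topspace X"
  shows "TC X Y f \<le> cat X x0 + cat X x0 * sec X Y f - 1"
proof (cases "cat X x0")
  case m: (enat m)
  let ?P = "based_path_space X x0"
  obtain U where U: "sectional_filtration ?P X (\<lambda>\<alpha>. \<alpha> 1) m U"
    using sec_finiteE m unfolding cat_def by blast
  have m0: "0 < m" using sectional_filtration_length_pos[OF U] assms(7) by blast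
  show ?thesis
  proof (cases "sec X Y f")
    case n: (enat n)
    obtain V where V: "sectional_filtration X Y f n V" using sec_finiteE[OF n] .
    have n0: "0 < n" using sectional_filtration_length_pos[OF V] assms(6,7) by blast
    obtain W where W: "sectional_filtration ?P Y (f \<circ> (\<lambda>\<alpha>. \<alpha> 1)) (m * n) W"
      using sectional_filtration_compose[OF U V m0] by blast
    obtain Q where "sectional_filtration (prod_topology ?P ?P) (prod_topology X Y)
        (map_prod (\<lambda>\<alpha>. \<alpha> 1) (f \<circ> (\<lambda>\<alpha>. \<alpha> 1))) (m + m * n - 1) Q"
      using sectional_filtration_prod[OF U W] m0 n0 by auto
    \<comment> \<open>For based paths \<open>a\<close> and \<open>b\<close> the joined path runs
      from \<open>a 1\<close> to \<open>b 1\<close>, so \<open>rev_join\<close> lies over the pair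
      \<open>(a 1, f (b 1))\<close>.\<close>
    then have "sectional_filtration (path_space X) (prod_topology X Y)
        (\<lambda>\<alpha>. (\<alpha> 0, f (\<alpha> 1))) (m + m * n - 1) Q"
      by (rule sectional_filtration_map[OF _ continuous_map_rev_join]) auto
    then have "TC X Y f \<le> enat (m + m * n - 1)" unfolding TC_def by (rule sec_le)
    then show ?thesis by (simp add: m n one_enat_def)
  next
    case infinity
    \<comment> \<open>Since 0 times \<infinity> is 0 in \<open>enat\<close>, positivity of
      \<open>m\<close> is what makes the right-hand side infinite.\<close>
    then show ?thesis using m m0 by (simp add: zero_enat_def one_enat_def)
  qed
next
  case infinity
  then show ?thesis by (simp add: one_enat_def)
qed

end
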